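(* Let $\Omega\subset\mathbb{R}^n$ be a bounded domain with outer boundary $\partial\Omega$, let $\Omega_C$ be a subdomain (the cell) completely embedded in $\Omega$, and let $\Gamma_C=\partial\Omega_C$ be its boundary, over which internal forces are exerted. Let $\boldsymbol{u}_H$ be a solution to the "hole" problem $$-\nabla\cdot\boldsymbol{\sigma}(\boldsymbol{u}_H)=\boldsymbol{0}\ \text{ in }\Omega\setminus\overline{\Omega}_C,\qquad \boldsymbol{\sigma}(\boldsymbol{u}_H)\cdot\boldsymbol{n}=P(\boldsymbol{x})\boldsymbol{n}(\boldsymbol{x})\ \text{ on }\Gamma_C,\qquad \boldsymbol{\sigma}(\boldsymbol{u}_H)\cdot\boldsymbol{n}+\kappa\boldsymbol{u}_H=\boldsymbol{0}\ \text{ on }\partial\Omega,$$ and let $\boldsymbol{u}_I$ be a solution to the immersed boundary problem $$-\nabla\cdot\boldsymbol{\sigma}(\boldsymbol{u}_I)=\int_{\Gamma_C}P(\boldsymbol{x}')\,\boldsymbol{n}(\boldsymbol{x}')\,\delta(\boldsymbol{x}-\boldsymbol{x}')\,dS(\boldsymbol{x}')\ \text{ in }\Omega,\qquad \boldsymbol{\sigma}(\boldsymbol{u}_I)\cdot\boldsymbol{n}+\kappa\boldsymbol{u}_I=\boldsymbol{0}\ \text{ on }\partial\Omega.$$ Then $$\int_{\partial\Omega}\kappa\,\boldsymbol{u}_H\,dS=\int_{\partial\Omega}\kappa\,\boldsymbol{u}_I\,dS=\int_{\Gamma_C}P(\boldsymbol{x})\,\boldsymbol{n}(\boldsymbol{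x})\,dS.$$
   Context: For a displacement field $\boldsymbol{u}$, $\boldsymbol{\epsilon}(\boldsymbol{u})=\frac12[\nabla\boldsymbol{u}+(\nabla\boldsymbol{u})^T]$ and $$\boldsymbol{\sigma}(\boldsymbol{u})=\frac{E}{1+\nu}\Big\{\boldsymbol{\epsilon}(\boldsymbol{u})+\mathrm{tr}(\boldsymbol{\epsilon}(\boldsymbol{u}))\,\frac{\nu}{1-2\nu}\,\boldsymbol{I}\Big\},$$ with stiffness $E>0$ and Poisson's ratio $0\le\nu<1/2$. $P$ is a given continuous function (force magnitude per unit measure) and $\kappa$ is the spring coefficient. On $\Gamma_C$, $\boldsymbol{n}$ is the unit normal pointing into the cell $\Omega_C$ (hence outward from $\Omega\setminus\overline\Omega_C$); on $\partial\Omega$, $\boldsymbol{n}$ is the outward unit normal. $\delta$ is the Dirac delta distribution. Boundaries are assumed regular enough for traces and the divergence theorem. The boundary value problems are understood in the weak sense: $\boldsymbol{u}_H$ satisfies $$\int_{\Omega\setminus\overline\Omega_C}\boldsymbol{\sigma}(\boldsymbol{u}_H):\boldsymbol{\epsilon}(\boldsymbol{\phi})\,d\Omega+\int_{\partial\Omega}\kappa\,\boldsymbol{u}_H\cdot\boldsymbol{\phi}\,dS=\int_{\Gamma_C}P\,\boldsymbol{n}\cdot\boldsymbol{\phi}\,dS$$ for all $\boldsymbol{\phi}$ smooth up to the boundary of $\Omega\setminus\overline\Omega_C$, and $\boldsymbol{u}_I$ satisfies $$\int_{\Omega}\boldsymbol{\sigma}(\boldsymbol{u}_I):\boldsymbol{\epsilon}(\boldsymbol{\phi})\,d\Omega+\int_{\partial\Omega}\kappa\,\boldsymbol{u}_I\cdot\boldsymbol{\phi}\,dS=\int_{\Gamma_C}P\,\boldsymbol{n}\cdot\boldsymbol{\phi}\,dS$$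 for all $\boldsymbol{\phi}$ smooth on $\overline\Omega$, with $\boldsymbol{u}_H$, $\boldsymbol{u}_I$ having integrable gradient and integrable trace on $\partial\Omega$. *)

theory Defs
  imports "HOL-Analysis.Analysis"
begin

section \<open>Surface measure\<close>

text \<open>
  The integrals \<open>\<integral> \<dots> dS\<close> are taken with respect to the Hausdorff measure of
  codimension one, normalised so that it is the usual surface area
  (counting measure if the dimension is one).
\<close>

text \<open>The case distinction matters for \<open>s = 0\<close>, where \<open>0 ^ 0 = 1\<close> must count points only.\<close>

definition hausdorff_weight :: "nat \<Rightarrow> 'a::metric_space set \<Rightarrow> ennreal" where
  "hausdorff_weight s C =
     (if C = {} then 0 else ennreal (unit_ball_vol (real s) * (diameter C / 2) ^ s))"

definition hausdorff_pre :: "nat \<Rightarrow> real \<Rightarrow> 'a::metric_space set \<Rightarrow> ennreal" where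
  "hausdorff_pre s d A =
     (INF C \<in> {C :: nat \<Rightarrow> 'a set. A \<subseteq> (\<Union>i. C i) \<and> (\<forall>i. bounded (C i) \<and> diameter (C i) \<le> d)}.
        \<Sum>i. hausdorff_weight s (C i))"

definition hausdorff_outer :: "nat \<Rightarrow> 'a::metric_space set \<Rightarrow> ennreal" where
  "hausdorff_outer s A = (SUP d \<in> {0<..}. hausdorff_pre s d A)"

definition surface_measure :: "'a::euclidean_space measure" where
  "surface_measure = measure_of UNIV (sets borel) (hausdorff_outer (DIM('a) - 1))"

text \<open>
  \<^const>\<open>measure_of\<close> yields the null measure unless its last argument is a measure, so the
  Caratheodory criterion for metric outer measures is checked here.
\<close>

lemma hausdorff_weight_empty [simp]: "hausdorff_weight s {} = 0"
  by (simp add: hausdorff_weight_def)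

lemma hausdorff_pre_empty: "d > 0 \<Longrightarrow> hausdorff_pre s d {} = 0"
proof -
  assume "d > 0"
  then have "hausdorff_pre s d ({}::'a set) \<le> (\<Sum>i::nat. hausdorff_weight s ({}::'a set))"
    unfolding hausdorff_pre_def by (intro INF_lower) auto
  then show ?thesis by simp
qed

lemma hausdorff_pre_mono: "A \<subseteq> B \<Longrightarrow> hausdorff_pre s d A \<le> hausdorff_pre s d B"
  unfolding hausdorff_pre_def by (intro INF_superset_mono) auto

lemma hausdorff_pre_antimono: "d \<le> e \<Longrightarrow> hausdorff_pre s e A \<le> hausdorff_pre s d A"
  unfolding hausdorff_pre_def by (intro INF_superset_mono) (auto intro: order_trans)

lemma hausdorff_pre_UN:
  fixes A :: "nat \<Rightarrow> 'a::metric_space set"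
  shows "hausdorff_pre s d (\<Union>i. A i) \<le> (\<Sum>i. hausdorff_pre s d (A i))"
proof (rule ennreal_le_epsilon)
  fix e :: real assume fin: "(\<Sum>i. hausdorff_pre s d (A i)) < top" and e: "e > 0"
  define h where "h i = ennreal (e * (1/2) ^ Suc i)" for i
  let ?K = "\<lambda>B. {C :: nat \<Rightarrow> 'a set. B \<subseteq> (\<Union>i. C i) \<and> (\<forall>i. bounded (C i) \<and> diameter (C i) \<le> d)}"
  have hpos: "0 < h i" for i using e by (simp add: h_def)
  have finite: "hausdorff_pre s d (A i) < top" for i
  proof -
    have "hausdorff_pre s d (A i) \<le> (\<Sum>i. hausdorff_pre s d (A i))"
      using sum_le_suminf[of "\<lambda>i. hausdorff_pre s d (A i)" "{i}"] by simp
    with fin show ?thesis by (rule le_less_trans[rotated])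
  qed
  have "\<exists>C \<in> ?K (A i). (\<Sum>j. hausdorff_weight s (C j)) < hausdorff_pre s d (A i) + h i" for i
  proof -
    have "hausdorff_pre s d (A i) < hausdorff_pre s d (A i) + h i"
      using finite[of i] hpos[of i]
        ennreal_add_left_cancel_less[of "hausdorff_pre s d (A i)" 0 "h i"] by auto
    then have "(INF C \<in> ?K (A i). \<Sum>j. hausdorff_weight s (C j)) < hausdorff_pre s d (A i) + h i"
      by (simp only: hausdorff_pre_def[symmetric])
    then show ?thesis by (simp only: INF_less_iff)
  qed
  then have "\<forall>i. \<exists>C. C \<in> ?K (A i) \<and> (\<Sum>j. hausdorff_weight s (C j)) < hausdorff_pre s d (A i) + h i"
    by blast
  from choice[OF this] obtain C where C: "\<And>i. C i \<in> ?K (A i)"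
    and Cs: "\<And>i. (\<Sum>j. hausdorff_weight s (C i j)) < hausdorff_pre s d (A i) + h i"
    by blast
  define D where "D n = (case prod_decode n of (i, j) \<Rightarrow> C i j)" for n
  have D: "D (prod_encode (i, j)) = C i j" for i j by (simp add: D_def)
  have "(\<Union>i. A i) \<subseteq> (\<Union>n. D n)"
  proof
    fix x assume "x \<in> (\<Union>i. A i)"
    then obtain i j where "x \<in> C i j" using C by blast
    then show "x \<in> (\<Union>n. D n)" by (auto intro!: exI[of _ "prod_encode (i, j)"] simp: D)
  qed
  moreover have "bounded (D n) \<and> diameter (D n) \<le> d" for n
    using C by (auto simp: D_def split: prod.split)
  ultimately have "hausdorff_pre s d (\<Union>i. A i) \<le> (\<Sum>n. hausdorff_weight s (D n))"
    unfolding hausdorff_pre_def by (intro INF_lower) auto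
  also have "\<dots> = (\<Sum>i. \<Sum>j. hausdorff_weight s (C i j))"
    using suminf_ennreal_2dimen[of "\<lambda>i. \<Sum>j. hausdorff_weight s (C i j)"
        "\<lambda>(i, j). hausdorff_weight s (C i j)"]
    by (simp add: D_def case_prod_unfold)
  also have "\<dots> \<le> (\<Sum>i. hausdorff_pre s d (A i) + h i)"
    using Cs by (intro suminf_le) (auto intro: less_imp_le)
  also have "\<dots> = (\<Sum>i. hausdorff_pre s d (A i)) + (\<Sum>i. h i)"
    by (simp add: suminf_add)
  also have "(\<Sum>i. h i) = ennreal e"
    unfolding h_def using e sums_mult[OF power_half_series, of e]
    by (subst suminf_ennreal_eq[where x = e]) (auto simp: mult_ac)
  finally show "hausdorff_pre s d (\<Union>i. A i) \<le> (\<Sum>i. hausdorff_pre s d (A i)) + ennreal e" .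
qed

lemma hausdorff_outer_mono: "A \<subseteq> B \<Longrightarrow> hausdorff_outer s A \<le> hausdorff_outer s B"
  unfolding hausdorff_outer_def by (intro SUP_mono') (rule hausdorff_pre_mono)

lemma hausdorff_outer_empty [simp]: "hausdorff_outer s {} = 0"
  unfolding hausdorff_outer_def by (simp add: hausdorff_pre_empty)

lemma hausdorff_outer_UN:
  fixes A :: "nat \<Rightarrow> 'a::metric_space set"
  shows "hausdorff_outer s (\<Union>i. A i) \<le> (\<Sum>i. hausdorff_outer s (A i))"
  unfolding hausdorff_outer_def[of s "\<Union>i. A i"]
proof (rule SUP_least)
  fix d :: real assume "d \<in> {0<..}"
  have "hausdorff_pre s d (\<Union>i. A i) \<le> (\<Sum>i. hausdorff_pre s d (A i))"
    by (rule hausdorff_pre_UN)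
  also have "\<dots> \<le> (\<Sum>i. hausdorff_outer s (A i))"
    unfolding hausdorff_outer_def using \<open>d \<in> {0<..}\<close>
    by (intro suminf_le SUP_upper) auto
  finally show "hausdorff_pre s d (\<Union>i. A i) \<le> (\<Sum>i. hausdorff_outer s (A i))" .
qed

lemma hausdorff_outer_Un:
  fixes A B :: "'a::metric_space set"
  shows "hausdorff_outer s (A \<union> B) \<le> hausdorff_outer s A + hausdorff_outer s B"
proof -
  let ?S = "\<lambda>i::nat. if i = 0 then A else if i = 1 then B else {}"
  have "A \<union> B = (\<Union>i. ?S i)" by (auto split: if_splits)
  then have "hausdorff_outer s (A \<union> B) \<le> (\<Sum>i. hausdorff_outer s (?S i))"
    using hausdorff_outer_UN[of s ?S] by simp
  also have "\<dots> = (\<Sum>i\<in>{0,1}. hausdorff_outer s (?S i))"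
    by (intro suminf_finite) auto
  finally show ?thesis by simp
qed

lemma hausdorff_outer_separated:
  fixes A B :: "'a::metric_space set"
  assumes eta: "eta > 0" and sep: "\<And>x y. x \<in> A \<Longrightarrow> y \<in> B \<Longrightarrow> eta \<le> dist x y"
  shows "hausdorff_outer s A + hausdorff_outer s B \<le> hausdorff_outer s (A \<union> B)"
proof -
  have *: "hausdorff_pre s d A + hausdorff_pre s d B \<le> hausdorff_pre s d (A \<union> B)"
    if d: "0 < d" "d < eta" for d
    unfolding hausdorff_pre_def[of s d "A \<union> B"]
  proof (rule INF_greatest)
    fix C :: "nat \<Rightarrow> 'a set"
    assume "C \<in> {C. A \<union> B \<subseteq> (\<Union>i. C i) \<and> (\<forall>i. bounded (C i) \<and> diameter (C i) \<le> d)}"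
    then have cov: "A \<union> B \<subseteq> (\<Union>i. C i)" and bd: "\<And>i. bounded (C i)" and di: "\<And>i. diameter (C i) \<le> d"
      by auto
    define U where "U X i = (if C i \<inter> X = {} then {} else C i)" for X i
    have pre: "hausdorff_pre s d X \<le> (\<Sum>i. hausdorff_weight s (U X i))" if "X \<subseteq> (\<Union>i. C i)" for X
      unfolding hausdorff_pre_def
      using that bd di d by (intro INF_lower) (fastforce simp: U_def)
    have one: "C i \<inter> A = {} \<or> C i \<inter> B = {}" for i
    proof (rule ccontr)
      assume "\<not> ?thesis"
      then obtain x y where "x \<in> C i" "x \<in> A" "y \<in> C i" "y \<in> B" by blast
      then have "eta \<le> dist x y" "dist x y \<le> diameter (C i)"
        using sep bd diameter_bounded_bound by blast+
      with di[of i] d show False by simp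
    qed
    have "hausdorff_pre s d A + hausdorff_pre s d B
        \<le> (\<Sum>i. hausdorff_weight s (U A i)) + (\<Sum>i. hausdorff_weight s (U B i))"
      using cov by (intro add_mono pre) auto
    also have "\<dots> = (\<Sum>i. hausdorff_weight s (U A i) + hausdorff_weight s (U B i))"
      by (simp add: suminf_add)
    also have "\<dots> \<le> (\<Sum>i. hausdorff_weight s (C i))"
      using one by (intro suminf_le) (auto simp: U_def)
    finally show "hausdorff_pre s d A + hausdorff_pre s d B \<le> (\<Sum>i. hausdorff_weight s (C i))" .
  qed
  have "hausdorff_outer s A + hausdorff_outer s B
      = (SUP d\<in>{0<..}. hausdorff_pre s d A + hausdorff_outer s B)"
    unfolding hausdorff_outer_def[of s A] by (intro ennreal_SUP_add_left[symmetric]) auto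
  also have "\<dots> \<le> hausdorff_outer s (A \<union> B)"
  proof (rule SUP_least)
    fix d1 :: real assume d1: "d1 \<in> {0<..}"
    have "hausdorff_pre s d1 A + hausdorff_outer s B
        = (SUP d\<in>{0<..}. hausdorff_pre s d1 A + hausdorff_pre s d B)"
      unfolding hausdorff_outer_def[of s B] by (intro ennreal_SUP_add_right) auto
    also have "\<dots> \<le> hausdorff_outer s (A \<union> B)"
    proof (rule SUP_least)
      fix d2 :: real assume d2: "d2 \<in> {0<..}"
      define d where "d = min (eta/2) (min d1 d2)"
      have d: "0 < d" "d < eta" "d \<le> d1" "d \<le> d2" using d1 d2 eta by (auto simp: d_def)
      have "hausdorff_pre s d1 A + hausdorff_pre s d2 B \<le> hausdorff_pre s d A + hausdorff_pre s d B"
        using d by (intro add_mono hausdorff_pre_antimono)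
      also have "\<dots> \<le> hausdorff_pre s d (A \<union> B)" using d by (intro *)
      also have "\<dots> \<le> hausdorff_outer s (A \<union> B)"
        unfolding hausdorff_outer_def using d by (intro SUP_upper) auto
      finally show "hausdorff_pre s d1 A + hausdorff_pre s d2 B \<le> hausdorff_outer s (A \<union> B)" .
    qed
    finally show "hausdorff_pre s d1 A + hausdorff_outer s B \<le> hausdorff_outer s (A \<union> B)" .
  qed
  finally show ?thesis .
qed

lemma hausdorff_outer_closed:
  fixes F A :: "'a::metric_space set"
  assumes F: "closed F"
  shows "hausdorff_outer s (A \<inter> F) + hausdorff_outer s (A - F) \<le> hausdorff_outer s A"
proof (cases "F = {} \<or> hausdorff_outer s A = top")
  case True
  then show ?thesis by auto
next
  case False
  then have ne: "F \<noteq> {}" and fin: "hausdorff_outer s A < top" by (auto simp: less_top)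
  let ?m = "hausdorff_outer s"
  let ?g = "\<lambda>x. infdist x F"
  have sep: "?m S + ?m T \<le> ?m A"
    if "S \<subseteq> A" "T \<subseteq> A" "\<And>x. x \<in> S \<Longrightarrow> a \<le> ?g x" "\<And>y. y \<in> T \<Longrightarrow> ?g y \<le> b" "b < a" for S T a b
  proof -
    have "a - b \<le> dist x y" if "x \<in> S" "y \<in> T" for x y
      using infdist_triangle[of x F y] \<open>\<And>x. x \<in> S \<Longrightarrow> a \<le> ?g x\<close>[OF \<open>x \<in> S\<close>]
        \<open>\<And>y. y \<in> T \<Longrightarrow> ?g y \<le> b\<close>[OF \<open>y \<in> T\<close>] by linarith
    then have "?m S + ?m T \<le> ?m (S \<union> T)"
      using \<open>b < a\<close> by (intro hausdorff_outer_separated[of "a - b"]) auto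
    also have "\<dots> \<le> ?m A" using that by (intro hausdorff_outer_mono) auto
    finally show ?thesis .
  qed
  define R where "R k = {x \<in> A. 1 / real (k + 2) \<le> ?g x \<and> ?g x < 1 / real (k + 1)}" for k
  define T where "T n = {x \<in> A. 1 / real (n + 1) \<le> ?g x}" for n
  have chain: "(\<Sum>k<n. ?m (R (2 * k + c))) \<le> ?m (\<Union>k<n. R (2 * k + c))" for n c
  proof (induction n)
    case (Suc n)
    let ?U = "\<Union>k<n. R (2 * k + c)"
    have low: "1 / real (2 * n + c) \<le> ?g x" if "x \<in> ?U" for x
    proof -
      from that obtain k where k: "k < n" "1 / real (2 * k + c + 2) \<le> ?g x" by (auto simp: R_def)
      have "1 / real (2 * n + c) \<le> 1 / real (2 * k + c + 2)"
        using k(1) by (intro divide_left_mono) auto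
      with k(2) show ?thesis by linarith
    qed
    have "?m ?U + ?m (R (2 * n + c)) \<le> ?m (?U \<union> R (2 * n + c))"
    proof (cases "n = 0")
      case False
      let ?e = "1 / real (2 * n + c) - 1 / real (2 * n + c + 1)"
      show ?thesis
      proof (rule hausdorff_outer_separated[of ?e])
        show "0 < ?e" using False by (simp add: divide_strict_left_mono)
        fix x y assume "x \<in> ?U" "y \<in> R (2 * n + c)"
        then show "?e \<le> dist x y"
          using low[of x] infdist_triangle[of x F y] by (auto simp: R_def)
      qed
    qed simp
    moreover have "(\<Union>k<Suc n. R (2 * k + c)) = ?U \<union> R (2 * n + c)"
      by (auto simp: less_Suc_eq)
    ultimately show ?case
      using Suc.IH by (auto intro: order_trans add_right_mono)
  qed simp
  have bnd: "(\<Sum>k<n. ?m (R (2 * k + c))) \<le> ?m A" for n c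
    by (rule order_trans[OF chain hausdorff_outer_mono]) (auto simp: R_def)
  have "(\<Sum>k. ?m (R k)) \<le> ?m A + ?m A"
  proof (rule suminf_le_const)
    fix n
    have "(\<Sum>k<n. ?m (R k)) \<le> (\<Sum>k<2*n. ?m (R k))"
      by (intro sum_mono2) auto
    also have "\<dots> = (\<Sum>k<n. ?m (R (2 * k + 0))) + (\<Sum>k<n. ?m (R (2 * k + 1)))"
      by (induction n) (auto simp: algebra_simps)
    also have "\<dots> \<le> ?m A + ?m A" by (intro add_mono bnd)
    finally show "(\<Sum>k<n. ?m (R k)) \<le> ?m A + ?m A" .
  qed auto
  then have sfin: "(\<Sum>k. ?m (R k)) < top"
    using fin by (auto intro: le_less_trans simp: less_top)
  have "(\<lambda>n. \<Sum>k. ?m (R (k + n))) \<longlonglongrightarrow> 0"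
  proof -
    define r where "r k = enn2real (?m (R k))" for k
    have r: "?m (R k) = ennreal (r k)" for k
    proof -
      have "?m (R k) \<le> ?m A" by (intro hausdorff_outer_mono) (auto simp: R_def)
      then show ?thesis using fin by (auto simp: r_def intro: le_less_trans)
    qed
    have r0: "0 \<le> r k" for k by (simp add: r_def)
    have sr: "summable r"
      using sfin r0 by (intro summable_suminf_not_top) (auto simp: r less_top)
    have "(\<Sum>k. ?m (R (k + n))) = ennreal (\<Sum>k. r (k + n))" for n
      unfolding r using sr r0 by (intro suminf_ennreal2) (auto simp: summable_iff_shift)
    moreover have "(\<lambda>n. ennreal (\<Sum>k. r (k + n))) \<longlonglongrightarrow> ennreal 0"
      using suminf_exist_split2[OF sr] by (intro tendsto_ennrealI)
    ultimately show ?thesis by simp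
  qed
  then have lim: "(\<lambda>n. ?m A + (\<Sum>k. ?m (R (k + n)))) \<longlonglongrightarrow> ?m A + 0"
    by (intro tendsto_add) auto
  have "?m (A \<inter> F) + ?m (A - F) \<le> ?m A + (\<Sum>k. ?m (R (k + n)))" for n
  proof -
    have sub: "A - F \<subseteq> T n \<union> (\<Union>k. R (k + n))"
    proof
      fix x assume x: "x \<in> A - F"
      then have pos: "0 < ?g x"
        using F ne infdist_pos_not_in_closed by auto
      show "x \<in> T n \<union> (\<Union>k. R (k + n))"
      proof (cases "1 / real (n + 1) \<le> ?g x")
        case True with x show ?thesis by (auto simp: T_def)
      next
        case False
        obtain N where N: "1 / real (N + 1) < ?g x"
          using reals_Archimedean[OF pos] by (auto simp: inverse_eq_divide)
        define j where "j = (LEAST j. 1 / real (j + 1) \<le> ?g x)"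
        have j: "1 / real (j + 1) \<le> ?g x"
          unfolding j_def by (rule LeastI[of _ N]) (use N in simp)
        have "n < j"
        proof (rule ccontr)
          assume "\<not> n < j"
          then have "1 / real (n + 1) \<le> 1 / real (j + 1)" by (intro divide_left_mono) auto
          with j False show False by linarith
        qed
        then obtain k where k: "j = Suc (k + n)"
          by (metis add.commute less_imp_Suc_add)
        have "\<not> 1 / real (k + n + 1) \<le> ?g x"
          using not_less_Least[of "k + n" "\<lambda>j. 1 / real (j + 1) \<le> ?g x"] k by (simp add: j_def)
        with j k x have "x \<in> R (k + n)" by (simp add: R_def add.commute)
        then show ?thesis by blast
      qed
    qed
    have "?m (A \<inter> F) + ?m (A - F) \<le> ?m (A \<inter> F) + (?m (T n) + (\<Sum>k. ?m (R (k + n))))"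
    proof (intro add_left_mono)
      have "?m (A - F) \<le> ?m (T n) + ?m (\<Union>k. R (k + n))"
        by (rule order_trans[OF hausdorff_outer_mono[OF sub] hausdorff_outer_Un])
      also have "\<dots> \<le> ?m (T n) + (\<Sum>k. ?m (R (k + n)))"
        by (intro add_left_mono hausdorff_outer_UN)
      finally show "?m (A - F) \<le> ?m (T n) + (\<Sum>k. ?m (R (k + n)))" .
    qed
    also have "\<dots> = (?m (T n) + ?m (A \<inter> F)) + (\<Sum>k. ?m (R (k + n)))"
      by (simp add: ac_simps)
    also have "\<dots> \<le> ?m A + (\<Sum>k. ?m (R (k + n)))"
      by (intro add_right_mono sep[of _ _ "1 / real (n + 1)" 0]) (auto simp: T_def)
    finally show ?thesis .
  qed
  then show ?thesis using LIMSEQ_le_const[OF lim] by auto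
qed

lemma measure_space_hausdorff: "measure_space UNIV (sets borel) (hausdorff_outer s)"
proof -
  let ?m = "hausdorff_outer s :: 'a set \<Rightarrow> ennreal"
  let ?L = "lambda_system UNIV (Pow UNIV) ?m"
  interpret P: sigma_algebra UNIV "Pow UNIV :: 'a set set" by (rule sigma_algebra_Pow)
  have "outer_measure_space (Pow UNIV) ?m"
    by (auto simp: outer_measure_space_def positive_def increasing_def countably_subadditive_def
        intro: hausdorff_outer_mono hausdorff_outer_UN)
  then have L: "measure_space UNIV ?L ?m" by (rule P.caratheodory_lemma)
  then interpret L: sigma_algebra UNIV ?L by (simp add: measure_space_def)
  have closed: "F \<in> ?L" if "closed F" for F
  proof -
    have "?m (A \<inter> F) + ?m (A - F) = ?m A" for A
      using hausdorff_outer_closed[OF that, of s A] hausdorff_outer_Un[of s "A \<inter> F" "A - F"]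
      by (simp add: Int_Diff_Un antisym)
    then show ?thesis unfolding P.lambda_system_eq by blast
  qed
  have "sigma_sets UNIV (Collect closed) \<subseteq> ?L"
    using closed by (intro L.sigma_sets_subset) blast
  then have sub: "sets borel \<subseteq> ?L"
    by (simp add: borel_eq_closed)
  show ?thesis
    using L sub sets.sigma_algebra_axioms[of "borel :: 'a measure"]
    by (auto simp: measure_space_def positive_def countably_additive_def)
qed

lemma space_surface_measure [simp]: "space surface_measure = UNIV"
  by (simp add: surface_measure_def)

lemma sets_surface_measure [simp, measurable_cong]: "sets surface_measure = sets borel"
  unfolding surface_measure_def using sets.sigma_sets_eq[of borel] by simp

lemma emeasure_surface_measure:
  fixes A :: "'a::euclidean_space set"
  assumes "A \<in> sets borel"
  shows "emeasure surface_measure A = hausdorff_outer (DIM('a) - 1) A"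
proof -
  have "(surface_measure :: 'a measure) = measure_of UNIV (sets borel) (hausdorff_outer (DIM('a) - 1))"
    by (rule surface_measure_def)
  then show ?thesis
    using measure_space_hausdorff[of "DIM('a) - 1"] assms sets.sigma_sets_eq[of "borel :: 'a measure"]
    by (intro emeasure_measure_of[of _ UNIV "sets borel"])
       (auto simp: measure_space_def)
qed


section \<open>Smooth functions\<close>

fun higher_differentiable_on ::
    "'a::real_normed_vector set \<Rightarrow> ('a \<Rightarrow> 'b::real_normed_vector) \<Rightarrow> nat \<Rightarrow> bool" where
  "higher_differentiable_on U f 0 \<longleftrightarrow> continuous_on U f"
| "higher_differentiable_on U f (Suc k) \<longleftrightarrow>
     (\<forall>x\<in>U. f differentiable (at x)) \<and>
     (\<forall>v. higher_differentiable_on U (\<lambda>x. frechet_derivative f (at x) v) k)"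

definition smooth_on :: "'a::real_normed_vector set \<Rightarrow> ('a \<Rightarrow> 'b::real_normed_vector) \<Rightarrow> bool" where
  "smooth_on U f \<longleftrightarrow> (\<forall>k. higher_differentiable_on U f k)"

definition smooth_up_to_boundary ::
    "'a::real_normed_vector set \<Rightarrow> ('a \<Rightarrow> 'b::real_normed_vector) \<Rightarrow> bool" where
  "smooth_up_to_boundary D f \<longleftrightarrow> (\<exists>U. open U \<and> closure D \<subseteq> U \<and> smooth_on U f)"

definition support :: "('a::topological_space \<Rightarrow> 'b::zero) \<Rightarrow> 'a set" where
  "support f = closure {x. f x \<noteq> 0}"

definition divergence :: "(real^'n \<Rightarrow> real^'n) \<Rightarrow> real^'n \<Rightarrow> real" where
  "divergence F x = trace (jacobian F (at x))"


section \<open>Normals and regular boundaries\<close>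

text \<open>
  \<open>v\<close> is normal to \<open>\<partial>D\<close> at \<open>x\<close>, pointing out of \<open>D\<close>: near \<open>x\<close>, and off arbitrarily thin cones around
  the hyperplane \<open>x + v\<^sup>\<bottom>\<close>, the set \<open>D\<close> occupies the side \<open>(y - x) \<bullet> v < 0\<close> and its complement
  the other one.
\<close>

definition is_outward_unit_normal :: "'a::euclidean_space set \<Rightarrow> 'a \<Rightarrow> 'a \<Rightarrow> bool" where
  "is_outward_unit_normal D x v \<longleftrightarrow>
     norm v = 1 \<and>
     (\<forall>e>0. \<forall>\<^sub>F y in at x.
        (e * norm (y - x) < (y - x) \<bullet> v \<longrightarrow> y \<notin> D) \<and>
        ((y - x) \<bullet> v < - (e * norm (y - x)) \<longrightarrow> y \<in> D))"

lemma is_outward_unit_normal_unique: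
  assumes v: "is_outward_unit_normal D x v" and w: "is_outward_unit_normal D x w"
  shows "v = w"
proof (rule ccontr)
  assume ne: "v \<noteq> w"
  have n: "v \<bullet> v = 1" "w \<bullet> w = 1"
    using v w by (simp_all add: is_outward_unit_normal_def norm_eq_1)
  define d where "d = v - w"
  have d0: "d \<noteq> 0" using ne by (simp add: d_def)
  define a where "a = 1 - v \<bullet> w"
  have "0 < d \<bullet> d" using d0 by simp
  then have a: "0 < a" by (simp add: a_def d_def n inner_diff inner_commute)
  have dv: "d \<bullet> v = a" "d \<bullet> w = - a"
    by (simp_all add: d_def a_def n inner_diff inner_commute)
  define e where "e = a / (2 * norm d)"
  have e: "e > 0" and ed: "e * norm d = a / 2" using a d0 by (auto simp: e_def)
  have "\<forall>\<^sub>F y in at x. (e * norm (y - x) < (y - x) \<bullet> v \<longrightarrow> y \<notin> D) \<and>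
      ((y - x) \<bullet> w < - (e * norm (y - x)) \<longrightarrow> y \<in> D)"
    using v w e unfolding is_outward_unit_normal_def by (auto simp: eventually_conj_iff)
  then obtain r where r: "r > 0"
    and R: "\<And>y. y \<noteq> x \<Longrightarrow> dist y x < r \<Longrightarrow>
      (e * norm (y - x) < (y - x) \<bullet> v \<longrightarrow> y \<notin> D) \<and> ((y - x) \<bullet> w < - (e * norm (y - x)) \<longrightarrow> y \<in> D)"
    by (auto simp: eventually_at)
  define t where "t = r / (2 * norm d)"
  have t: "t > 0" "t * norm d < r" using r d0 by (auto simp: t_def)
  have "t * (a / 2) < t * a" using t a by simp
  moreover have "e * (t * norm d) = t * (a / 2)" using ed by (simp add: algebra_simps)
  ultimately show False
    using R[of "x + t *\<^sub>R d"] t d0 by (auto simp: dist_norm dv)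
qed

definition outward_unit_normal :: "'a::euclidean_space set \<Rightarrow> 'a \<Rightarrow> 'a" where
  "outward_unit_normal D x =
     (if \<exists>v. is_outward_unit_normal D x v then THE v. is_outward_unit_normal D x v else 0)"

text \<open>
  Regularity of the boundary: a normal almost everywhere, finite area, and the divergence
  theorem.
\<close>

definition regular_boundary :: "(real^'n) set \<Rightarrow> bool" where
  "regular_boundary D \<longleftrightarrow>
     emeasure surface_measure (frontier D) < \<infinity> \<and>
     (AE x in surface_measure. x \<in> frontier D \<longrightarrow> (\<exists>v. is_outward_unit_normal D x v)) \<and>
     set_borel_measurable surface_measure (frontier D) (outward_unit_normal D) \<and>
     (\<forall>F :: real^'n \<Rightarrow> real^'n. smooth_up_to_boundary D F \<longrightarrow>
        (LINT x:D|lebesgue. divergence F x) =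
        (LINT x:frontier D|surface_measure. F x \<bullet> outward_unit_normal D x))"


section \<open>Weak gradients and traces\<close>

text \<open>Row \<open>i\<close> of \<open>G x\<close> is the gradient of the \<open>i\<close>-th component of \<open>u\<close>, as in \<^const>\<open>jacobian\<close>.\<close>

definition has_weak_gradient ::
    "(real^'n) set \<Rightarrow> (real^'n \<Rightarrow> real^'m) \<Rightarrow> (real^'n \<Rightarrow> real^'n^'m) \<Rightarrow> bool" where
  "has_weak_gradient D u G \<longleftrightarrow>
     (\<forall>K. compact K \<and> K \<subseteq> D \<longrightarrow> set_integrable lebesgue K u \<and> set_integrable lebesgue K G) \<and>
     (\<forall>F :: real^'n \<Rightarrow> real^'n. smooth_on UNIV F \<and> compact (support F) \<and> support F \<subseteq> D \<longrightarrow>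
        (LINT x:D|lebesgue. divergence F x *\<^sub>R u x) = - (LINT x:D|lebesgue. G x *v F x))"

text \<open>
  \<open>T\<close> is the trace, on the part \<open>S\<close> of \<open>\<partial>D\<close>, of the function \<open>u\<close> with weak gradient \<open>G\<close>: it is the
  function satisfying Green's formula against all smooth fields vanishing near the rest of the
  boundary. This determines \<open>T\<close> up to null sets of \<open>S\<close>.
\<close>

definition has_trace_on ::
    "(real^'n) set \<Rightarrow> (real^'n) set \<Rightarrow> (real^'n \<Rightarrow> real^'m) \<Rightarrow> (real^'n \<Rightarrow> real^'n^'m) \<Rightarrow>
     (real^'n \<Rightarrow> real^'m) \<Rightarrow> bool" where
  "has_trace_on D S u G T \<longleftrightarrow>
     set_integrable lebesgue D u \<and> set_integrable lebesgue D G \<and>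
     set_integrable surface_measure S T \<and>
     (\<forall>F :: real^'n \<Rightarrow> real^'n. smooth_on UNIV F \<and> support F \<inter> (frontier D - S) = {} \<longrightarrow>
        (LINT x:D|lebesgue. divergence F x *\<^sub>R u x + G x *v F x) =
        (LINT x:S|surface_measure. (F x \<bullet> outward_unit_normal D x) *\<^sub>R T x))"


section \<open>Linear elasticity\<close>

text \<open>Strain and stress as functions of the displacement gradient.\<close>

definition strain :: "real^'n^'n \<Rightarrow> real^'n^'n" where
  "strain G = (1/2) *\<^sub>R (G + transpose G)"

definition stress :: "real \<Rightarrow> real \<Rightarrow> real^'n^'n \<Rightarrow> real^'n^'n" where
  "stress E \<nu> G =
     (E / (1 + \<nu>)) *\<^sub>R (strain G + (trace (strain G) * (\<nu> / (1 - 2 * \<nu>))) *\<^sub>R mat 1)"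

text \<open>
  \<open>u\<close>, with trace \<open>T\<close> on the outer boundary \<open>S\<close>, is a weak solution in \<open>D\<close> of the elasticity equations
  with the spring condition on \<open>S\<close>, loaded by the force density \<open>g\<close> on the surface \<open>\<Gamma>\<close>. The double
  contraction of matrices is their inner product.
\<close>

definition weak_elastic_solution ::
    "real \<Rightarrow> real \<Rightarrow> real \<Rightarrow> (real^'n) set \<Rightarrow> (real^'n) set \<Rightarrow> (real^'n) set \<Rightarrow> (real^'n \<Rightarrow> real^'n) \<Rightarrow>
     (real^'n \<Rightarrow> real^'n) \<Rightarrow> (real^'n \<Rightarrow> real^'n) \<Rightarrow> bool" where
  "weak_elastic_solution E \<nu> \<kappa> D S \<Gamma> g u T \<longleftrightarrow>
     (\<exists>G. has_weak_gradient D u G \<and> has_trace_on D S u G T \<and>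
        (\<forall>\<phi> :: real^'n \<Rightarrow> real^'n. smooth_up_to_boundary D \<phi> \<longrightarrow>
           (LINT x:D|lebesgue. stress E \<nu> (G x) \<bullet> strain (jacobian \<phi> (at x))) +
           (LINT x:S|surface_measure. (\<kappa> *\<^sub>R T x) \<bullet> \<phi> x) =
           (LINT x:\<Gamma>|surface_measure. g x \<bullet> \<phi> x)))"

text \<open>
  On the cell boundary the unit normal points into the cell, whence the minus sign.
\<close>

definition cell_force :: "(real^'n) set \<Rightarrow> (real^'n \<Rightarrow> real) \<Rightarrow> real^'n \<Rightarrow> real^'n" where
  "cell_force \<Omega>\<^sub>C P x = P x *\<^sub>R (- outward_unit_normal \<Omega>\<^sub>C x)"

definition hole_solution ::
    "real \<Rightarrow> real \<Rightarrow> real \<Rightarrow> (real^'n) set \<Rightarrow> (real^'n) set \<Rightarrow> (real^'n \<Rightarrow> real) \<Rightarrow>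
     (real^'n \<Rightarrow> real^'n) \<Rightarrow> (real^'n \<Rightarrow> real^'n) \<Rightarrow> bool" where
  "hole_solution E \<nu> \<kappa> \<Omega> \<Omega>\<^sub>C P u T \<longleftrightarrow>
     weak_elastic_solution E \<nu> \<kappa> (\<Omega> - closure \<Omega>\<^sub>C) (frontier \<Omega>) (frontier \<Omega>\<^sub>C) (cell_force \<Omega>\<^sub>C P) u T"

definition immersed_solution ::
    "real \<Rightarrow> real \<Rightarrow> real \<Rightarrow> (real^'n) set \<Rightarrow> (real^'n) set \<Rightarrow> (real^'n \<Rightarrow> real) \<Rightarrow>
     (real^'n \<Rightarrow> real^'n) \<Rightarrow> (real^'n \<Rightarrow> real^'n) \<Rightarrow> bool" where
  "immersed_solution E \<nu> \<kappa> \<Omega> \<Omega>\<^sub>C P u T \<longleftrightarrow>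
     weak_elastic_solution E \<nu> \<kappa> \<Omega> (frontier \<Omega>) (frontier \<Omega>\<^sub>C) (cell_force \<Omega>\<^sub>C P) u T"

end

theory Submission
  imports Defs
begin

text \<open>
  The identity is the balance of forces. A constant field is an admissible test function whose
  strain vanishes, so testing a weak solution against the constant fields leaves only the two
  surface terms: the total spring force on the outer boundary equals the total load
  (\<open>weak_elastic_solution_force_balance\<close>). The hole problem and the immersed problem live on
  different domains but carry the same load, so their total spring forces agree. The only analytic
  point is that the surface densities have to be integrable before the constant vector can be
  taken out of the integrals. For the spring force this is part of the notion of trace; the load
  is, on a boundary of finite area, a measurable unit normal field times a bounded continuous
  function (\<open>set_integrable_cell_force\<close>).
\<close>

lemma higher_differentiable_on_const: "higher_differentiable_on U (\<lambda>_. c) k"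
  by (induction k arbitrary: c) simp_all

lemma smooth_up_to_boundary_const: "smooth_up_to_boundary D (\<lambda>_. c)"
  unfolding smooth_up_to_boundary_def smooth_on_def
  using higher_differentiable_on_const by blast

lemma strain_jacobian_const: "strain (jacobian (\<lambda>_. c) (at x)) = 0"
  by (simp add: jacobian_def strain_def matrix_def transpose_def vec_eq_iff)

lemma set_integral_inner_const:
  fixes f :: "'a \<Rightarrow> 'b::euclidean_space"
  assumes "set_integrable M A f"
  shows "(LINT x:A|M. f x \<bullet> c) = (LINT x:A|M. f x) \<bullet> c"
  using assms integral_inner_left[of c M "\<lambda>x. indicat_real A x *\<^sub>R f x"]
  by (simp add: set_lebesgue_integral_def set_integrable_def)

lemma weak_elastic_solution_force_balance:
  assumes sol: "weak_elastic_solution E \<nu> \<kappa> D S \<Gamma> g u T"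
    and g: "set_integrable surface_measure \<Gamma> g"
  shows "(LINT x:S|surface_measure. \<kappa> *\<^sub>R T x) = (LINT x:\<Gamma>|surface_measure. g x)"
proof (rule vector_eq_rdot[THEN iffD1], rule allI)
  fix c
  obtain G where tr: "has_trace_on D S u G T"
    and weak: "\<And>\<phi>. smooth_up_to_boundary D \<phi> \<Longrightarrow>
        (LINT x:D|lebesgue. stress E \<nu> (G x) \<bullet> strain (jacobian \<phi> (at x))) +
        (LINT x:S|surface_measure. (\<kappa> *\<^sub>R T x) \<bullet> \<phi> x) =
        (LINT x:\<Gamma>|surface_measure. g x \<bullet> \<phi> x)"
    using sol unfolding weak_elastic_solution_def by blast
  have T: "set_integrable surface_measure S (\<lambda>x. \<kappa> *\<^sub>R T x)"
    using tr by (simp add: has_trace_on_def)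
  have "(LINT x:S|surface_measure. (\<kappa> *\<^sub>R T x) \<bullet> c) = (LINT x:\<Gamma>|surface_measure. g x \<bullet> c)"
    using weak[OF smooth_up_to_boundary_const[of D c]]
    by (simp add: strain_jacobian_const set_lebesgue_integral_def)
  then show "(LINT x:S|surface_measure. \<kappa> *\<^sub>R T x) \<bullet> c = (LINT x:\<Gamma>|surface_measure. g x) \<bullet> c"
    by (simp only: set_integral_inner_const[OF T] set_integral_inner_const[OF g])
qed

text \<open>The bound includes the points without a normal, where \<^const>\<open>outward_unit_normal\<close> is zero.\<close>

lemma norm_outward_unit_normal_le: "norm (outward_unit_normal D x) \<le> 1"
proof (cases "\<exists>v. is_outward_unit_normal D x v")
  case True
  then obtain v where v: "is_outward_unit_normal D x v" by blast
  then have "(THE v. is_outward_unit_normal D x v) = v"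
    by (blast intro: is_outward_unit_normal_unique)
  then have "outward_unit_normal D x = v"
    using True by (simp add: outward_unit_normal_def)
  then show ?thesis
    using v by (simp add: is_outward_unit_normal_def)
qed (simp add: outward_unit_normal_def)

lemma set_integrable_cell_force:
  fixes \<Omega>\<^sub>C :: "(real^'n) set"
  assumes reg: "regular_boundary \<Omega>\<^sub>C" and bdd: "bounded \<Omega>\<^sub>C"
    and P: "continuous_on (frontier \<Omega>\<^sub>C) P"
  shows "set_integrable surface_measure (frontier \<Omega>\<^sub>C) (cell_force \<Omega>\<^sub>C P)"
proof -
  let ?\<Gamma> = "frontier \<Omega>\<^sub>C" and ?n = "outward_unit_normal \<Omega>\<^sub>C"
  have "compact (P ` ?\<Gamma>)"
    using P compact_frontier_bounded[OF bdd] by (rule compact_continuous_image)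
  then obtain B where B: "\<And>x. x \<in> ?\<Gamma> \<Longrightarrow> norm (P x) \<le> B"
    by (meson compact_imp_bounded bounded_iff imageI)
  have "(\<lambda>x. indicator ?\<Gamma> x *\<^sub>R P x) \<in> borel_measurable surface_measure"
    using borel_measurable_continuous_on_indicator[OF _ P] by simp
  moreover have "(\<lambda>x. indicat_real ?\<Gamma> x *\<^sub>R ?n x) \<in> borel_measurable surface_measure"
    using reg by (simp add: regular_boundary_def set_borel_measurable_def)
  ultimately have "(\<lambda>x. - ((indicator ?\<Gamma> x *\<^sub>R P x) *\<^sub>R (indicat_real ?\<Gamma> x *\<^sub>R ?n x)))
      \<in> borel_measurable surface_measure"
    by measurable
  also have "(\<lambda>x. - ((indicator ?\<Gamma> x *\<^sub>R P x) *\<^sub>R (indicat_real ?\<Gamma> x *\<^sub>R ?n x)))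
      = (\<lambda>x. indicat_real ?\<Gamma> x *\<^sub>R cell_force \<Omega>\<^sub>C P x)"
    by (auto simp: cell_force_def indicator_def)
  finally have meas: "(\<lambda>x. indicat_real ?\<Gamma> x *\<^sub>R cell_force \<Omega>\<^sub>C P x) \<in> borel_measurable surface_measure" .
  have bnd: "norm (cell_force \<Omega>\<^sub>C P x) \<le> B" if "x \<in> ?\<Gamma>" for x
    using mult_mono[OF B[OF that] norm_outward_unit_normal_le[of \<Omega>\<^sub>C x]] B[OF that]
    by (simp add: cell_force_def)
  show ?thesis
    unfolding set_integrable_def
  proof (rule integrableI_bounded_set[where A = ?\<Gamma>])
    show "?\<Gamma> \<in> sets surface_measure" by simp
    show "emeasure surface_measure ?\<Gamma> < \<infinity>" using reg by (simp add: regular_boundary_def)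
    show "AE x in surface_measure. x \<in> ?\<Gamma> \<longrightarrow>
        norm (indicat_real ?\<Gamma> x *\<^sub>R cell_force \<Omega>\<^sub>C P x) \<le> B"
      using bnd by simp
  qed (use meas in simp_all)
qed

theorem proposition3p2:
  fixes \<Omega> \<Omega>\<^sub>C :: "(real^'n) set"
    and P :: "real^'n \<Rightarrow> real"
    and E \<nu> \<kappa> :: real
    and u\<^sub>H T\<^sub>H u\<^sub>I T\<^sub>I :: "real^'n \<Rightarrow> real^'n"
  assumes "open \<Omega>" "connected \<Omega>" "\<Omega> \<noteq> {}" "bounded \<Omega>"
    and "open \<Omega>\<^sub>C" "connected \<Omega>\<^sub>C" "\<Omega>\<^sub>C \<noteq> {}" "closure \<Omega>\<^sub>C \<subseteq> \<Omega>"
    and "regular_boundary \<Omega>" "regular_boundary \<Omega>\<^sub>C"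
    and "E > 0" "0 \<le> \<nu>" "\<nu> < 1/2"
    and "continuous_on (frontier \<Omega>\<^sub>C) P"
    and "hole_solution E \<nu> \<kappa> \<Omega> \<Omega>\<^sub>C P u\<^sub>H T\<^sub>H"
    and "immersed_solution E \<nu> \<kappa> \<Omega> \<Omega>\<^sub>C P u\<^sub>I T\<^sub>I"
  shows "(LINT x:frontier \<Omega>|surface_measure. \<kappa> *\<^sub>R T\<^sub>H x)
           = (LINT x:frontier \<Omega>|surface_measure. \<kappa> *\<^sub>R T\<^sub>I x)
         \<and> (LINT x:frontier \<Omega>|surface_measure. \<kappa> *\<^sub>R T\<^sub>I x)
           = (LINT x:frontier \<Omega>\<^sub>C|surface_measure. P x *\<^sub>R (- outward_unit_normal \<Omega>\<^sub>C x))"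
proof -
  have "bounded \<Omega>\<^sub>C"
    using assms(4,8) by (meson bounded_subset closure_subset)
  then have g: "set_integrable surface_measure (frontier \<Omega>\<^sub>C) (cell_force \<Omega>\<^sub>C P)"
    using assms(10,14) by (intro set_integrable_cell_force)
  note balance = weak_elastic_solution_force_balance[OF _ g, unfolded cell_force_def]
  show ?thesis
    using balance[OF assms(15)[unfolded hole_solution_def cell_force_def[abs_def]]]
      balance[OF assms(16)[unfolded immersed_solution_def cell_force_def[abs_def]]]
    by simp
qed

end
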